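(* Let $G_1$ and $G_2$ be two connected graphs. Then $G_1\times G_2$ is of QE class if and only if both $G_1$ and $G_2$ are of QE class.
   Context: All graphs are finite, simple and unweighted (undirected). A connected graph $G=(V,E)$ is of QE class if there is a map $\psi:V\to\mathcal{H}$ into a Euclidean space $\mathcal{H}$ with $d(i,j)=\|\psi(i)-\psi(j)\|^2$ for all $i,j\in V$, where $d$ is the graph (shortest-path) distance; by Schoenberg's theorem this is equivalent to the distance matrix $D_G$ satisfying $f^TD_Gf\le 0$ for all $f\in\mathbb{R}^V$ whose entries sum to $0$. The Cartesian product $G_1\times G_2$ of $G_1=(V_1,E_1)$ and $G_2=(V_2,E_2)$ has vertex set $V_1\times V_2$, with $(u,v)$ and $(u',v')$ adjacent iff either $u\sim u'$ in $G_1$ and $v=v'$, or $u=u'$ and $v\sim v'$ in $G_2$. *)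

theory Defs
  imports
    "Graph_Theory.Digraph_Component"
    "Graph_Theory.Shortest_Path"
    "HOL-Analysis.L2_Norm"
begin

text \<open>
  A finite simple undirected graph is a \<^locale>\<open>pair_graph\<close>: finite vertex set, no loops, arcs are
  ordered pairs of vertices closed under reversal, so an edge is a pair of opposite arcs.
  Connectedness is \<^const>\<open>Digraph_Component.connected\<close>, written qualified because of its
  topological namesake; it excludes the graph without vertices.
\<close>

definition graph_dist :: "'a pair_pre_digraph \<Rightarrow> 'a \<Rightarrow> 'a \<Rightarrow> real" where
  \<comment> \<open>Least number of arcs of a walk. The junk value 0 of \<^const>\<open>real_of_ereal\<close> at infinity arises
      only if there is no walk at all.\<close>
  "graph_dist G u v = real_of_ereal (wf_digraph.\<mu> (with_proj G) (\<lambda>_. 1) u v)"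

definition qe_class :: "'a pair_pre_digraph \<Rightarrow> bool" where
  \<comment> \<open>The Euclidean space is \<open>R\<close> to the power \<open>n\<close>, with \<open>n\<close> existentially quantified; a point is
      given by its coordinates \<open>0, \<dots>, n - 1\<close>, and \<^const>\<open>L2_set\<close> is the Euclidean norm.\<close>
  "qe_class G \<longleftrightarrow>
     Digraph_Component.connected (with_proj G) \<and>
     (\<exists>(n :: nat) (\<psi> :: 'a \<Rightarrow> nat \<Rightarrow> real).
        \<forall>i \<in> pverts G. \<forall>j \<in> pverts G.
          graph_dist G i j = (L2_set (\<lambda>k. \<psi> i k - \<psi> j k) {..<n})\<^sup>2)"

definition cartesian_product ::
  "'a pair_pre_digraph \<Rightarrow> 'b pair_pre_digraph \<Rightarrow> ('a \<times> 'b) pair_pre_digraph" where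
  "cartesian_product G\<^sub>1 G\<^sub>2 =
     \<lparr> pverts = pverts G\<^sub>1 \<times> pverts G\<^sub>2,
       parcs = {((u, v), (u', v')) | u v u' v'.
          u \<in> pverts G\<^sub>1 \<and> u' \<in> pverts G\<^sub>1 \<and> v \<in> pverts G\<^sub>2 \<and> v' \<in> pverts G\<^sub>2 \<and>
          ((u, u') \<in> parcs G\<^sub>1 \<and> v = v' \<or> u = u' \<and> (v, v') \<in> parcs G\<^sub>2)} \<rparr>"

lemma pair_graph_cartesian_product:
  assumes "pair_graph G\<^sub>1" "pair_graph G\<^sub>2"
  shows "pair_graph (cartesian_product G\<^sub>1 G\<^sub>2)"
proof -
  interpret G1: pair_graph G\<^sub>1 by fact
  interpret G2: pair_graph G\<^sub>2 by fact
  let ?P = "cartesian_product G\<^sub>1 G\<^sub>2"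
  have fin: "finite (pverts ?P)"
    using G1.pair_finite_verts G2.pair_finite_verts by (simp add: cartesian_product_def)
  have sub: "parcs ?P \<subseteq> pverts ?P \<times> pverts ?P"
    by (auto simp: cartesian_product_def)
  have sym: "sym (parcs ?P)"
    using G1.arcs_symmetric G2.arcs_symmetric by (auto simp: cartesian_product_def sym_def)
  show ?thesis
  proof unfold_locales
    show "finite (parcs ?P)" using fin sub by (meson finite_SigmaI finite_subset)
    show "fst e \<noteq> snd e" if "e \<in> parcs ?P" for e
      using that G1.pair_no_loops G2.pair_no_loops by (fastforce simp: cartesian_product_def)
    show "symmetric (with_proj ?P)"
      using sym by (simp add: symmetric_def arcs_ends_conv)
  qed (use fin sub in auto)
qed

end

theory Submission
  imports Defs
begin

text \<open>
  A walk in the product moves in exactly one coordinate at each step. Hence it projects to a walk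
  in each factor, and the lengths of the two projections add up to its own length; conversely, a
  walk in each factor can be run one after the other in the product. So the product distance is
  the sum of the two distances (\<open>graph_dist_cartesian_product\<close>). Sums of squared Euclidean
  distances are again squared Euclidean distances, by placing the coordinates of two embeddings
  side by side. Conversely, fixing a vertex of one factor embeds the other factor isometrically
  in the product, because the fixed coordinate contributes distance 0, so that an embedding of
  the product restricts to an embedding of each factor.
\<close>

section \<open>Distances as lengths of shortest walks\<close>

context pair_wf_digraph
begin

lemma awalk_cost_one: "awalk_cost (\<lambda>_. 1) p = real (length p)"
  by (simp add: awalk_cost_def sum_list_triv)

lemma graph_dist_minimal_walk:
  assumes "awalk u p v" and min: "\<And>q. awalk u q v \<Longrightarrow> length p \<le> length q"
  shows "graph_dist G u v = real (length p)"
proof -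
  have "\<mu> (\<lambda>_. 1) u v = ereal (real (length p))"
    unfolding \<mu>_def awalk_cost_one
    using assms by (intro INF_eqI) auto
  then show ?thesis
    by (simp add: graph_dist_def)
qed

lemma graph_dist_attained:
  assumes "awalk u p v"
  obtains q where "awalk u q v" "graph_dist G u v = real (length q)" "length q \<le> length p"
proof -
  obtain q where q: "awalk u q v" "\<And>r. awalk u r v \<Longrightarrow> length q \<le> length r"
    using ex_has_least_nat[of "\<lambda>q. awalk u q v" p length] assms by blast
  show thesis
    using that[OF q(1) graph_dist_minimal_walk[OF q] q(2)[OF assms]] .
qed

lemma graph_dist_le_length:
  assumes "awalk u p v"
  shows "graph_dist G u v \<le> real (length p)"
  using graph_dist_attained[OF assms] by fastforce

lemma graph_dist_self:
  assumes "u \<in> pverts G"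
  shows "graph_dist G u u = 0"
  using graph_dist_minimal_walk[of u "[]" u] assms by (simp add: awalk_Nil_iff)

end

text \<open>
  Connectedness is reachability in the symmetric closure, but here the arcs are already
  symmetric, so directed walks suffice.
\<close>

lemma (in pair_graph) connected_iff_awalk:
  "Digraph_Component.connected (with_proj G) \<longleftrightarrow>
     pverts G \<noteq> {} \<and> (\<forall>u \<in> pverts G. \<forall>v \<in> pverts G. \<exists>p. awalk u p v)"
proof -
  have "(parcs G)\<^sup>s = parcs G"
    by (auto simp: symcl_def arcs_symmetric)
  then show ?thesis
    unfolding connected_conv reachable_awalk[symmetric] reachable_def by simp
qed

section \<open>The distance of a Cartesian product\<close>

locale two_graphs = G1: pair_graph G1 + G2: pair_graph G2
  for G1 :: "'a pair_pre_digraph" and G2 :: "'b pair_pre_digraph"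
begin

sublocale P: pair_graph "cartesian_product G1 G2"
  by (rule pair_graph_cartesian_product) unfold_locales

lemma pverts_product [simp]: "pverts (cartesian_product G1 G2) = pverts G1 \<times> pverts G2"
  by (simp add: cartesian_product_def)

lemma parcs_product [simp]:
  "((u, v), (u', v')) \<in> parcs (cartesian_product G1 G2) \<longleftrightarrow>
     (u, u') \<in> parcs G1 \<and> v = v' \<and> v \<in> pverts G2 \<or>
     (v, v') \<in> parcs G2 \<and> u = u' \<and> u \<in> pverts G1"
  by (auto simp: cartesian_product_def dest: G1.wellformed' G2.wellformed')

lemma awalk_product_fst:
  assumes "G1.awalk u p u'" "v \<in> pverts G2"
  shows "P.awalk (u, v) (map (\<lambda>(a, b). ((a, v), (b, v))) p) (u', v)"
  using assms
  by (induction p arbitrary: u)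
    (auto simp: P.awalk_Nil_iff G1.awalk_Nil_iff P.awalk_Cons_iff G1.awalk_Cons_iff)

lemma awalk_product_snd:
  assumes "G2.awalk v p v'" "u \<in> pverts G1"
  shows "P.awalk (u, v) (map (\<lambda>(a, b). ((u, a), (u, b))) p) (u, v')"
  using assms
  by (induction p arbitrary: v)
    (auto simp: P.awalk_Nil_iff G2.awalk_Nil_iff P.awalk_Cons_iff G2.awalk_Cons_iff)

lemma awalk_product_combine:
  assumes p: "G1.awalk u p u'" and q: "G2.awalk v q v'"
  obtains r where "P.awalk (u, v) r (u', v')" "length r = length p + length q"
proof -
  have "v \<in> pverts G2" "u' \<in> pverts G1"
    using p q by (auto dest: G2.awalk_hd_in_verts G1.awalk_last_in_verts)
  with awalk_product_fst[OF p] awalk_product_snd[OF q] show thesis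
    by (intro that[OF P.awalk_appendI]) auto
qed

text \<open>
  Each arc of the product is an arc of exactly one factor and is constant in the other, so every
  arc of the walk is counted in just one of the two projections.
\<close>

lemma awalk_product_project:
  assumes "P.awalk (u, v) r (u', v')"
  obtains p q where "G1.awalk u p u'" "G2.awalk v q v'" "length r = length p + length q"
proof -
  have "\<exists>p q. G1.awalk u p u' \<and> G2.awalk v q v' \<and> length r = length p + length q"
    using assms
  proof (induction r arbitrary: u v)
    case Nil
    then have "G1.awalk u [] u'" "G2.awalk v [] v'"
      by (auto simp: P.awalk_Nil_iff G1.awalk_Nil_iff G2.awalk_Nil_iff)
    then show ?case
      by force
  next
    case (Cons e r)
    obtain w x where e: "e = ((u, v), (w, x))" "((u, v), (w, x)) \<in> parcs (cartesian_product G1 G2)"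
      and "P.awalk (w, x) r (u', v')"
      using Cons.prems by (cases e) (auto simp: P.awalk_Cons_iff)
    then obtain p q where pq: "G1.awalk w p u'" "G2.awalk x q v'" "length r = length p + length q"
      using Cons.IH by blast
    from e(2) consider "(u, w) \<in> parcs G1" "v = x" | "(v, x) \<in> parcs G2" "u = w"
      by auto
    then show ?case
    proof cases
      case 1
      then have "G1.awalk u ((u, w) # p) u'"
        using pq by (simp add: G1.awalk_Cons_iff)
      with 1 pq show ?thesis
        by (intro exI[of _ "(u, w) # p"] exI[of _ q]) auto
    next
      case 2
      then have "G2.awalk v ((v, x) # q) v'"
        using pq by (simp add: G2.awalk_Cons_iff)
      with 2 pq show ?thesis
        by (intro exI[of _ p] exI[of _ "(v, x) # q"]) auto
    qed
  qed
  then show thesis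
    using that by blast
qed

lemma connected_product:
  assumes "Digraph_Component.connected (with_proj G1)"
    and "Digraph_Component.connected (with_proj G2)"
  shows "Digraph_Component.connected (with_proj (cartesian_product G1 G2))"
proof -
  have "\<exists>r. P.awalk (u, v) r (u', v')"
    if verts: "u \<in> pverts G1" "u' \<in> pverts G1" "v \<in> pverts G2" "v' \<in> pverts G2"
    for u u' v v'
  proof -
    obtain p q where p: "G1.awalk u p u'" and q: "G2.awalk v q v'"
      using assms verts unfolding G1.connected_iff_awalk G2.connected_iff_awalk by blast
    obtain r where "P.awalk (u, v) r (u', v')"
      using awalk_product_combine[OF p q] .
    then show ?thesis ..
  qed
  moreover have "pverts G1 \<noteq> {}" "pverts G2 \<noteq> {}"
    using assms unfolding G1.connected_iff_awalk G2.connected_iff_awalk by simp_all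
  ultimately show ?thesis
    by (simp add: P.connected_iff_awalk)
qed

lemma graph_dist_cartesian_product:
  assumes "Digraph_Component.connected (with_proj G1)"
    and "Digraph_Component.connected (with_proj G2)"
    and "u \<in> pverts G1" "u' \<in> pverts G1" "v \<in> pverts G2" "v' \<in> pverts G2"
  shows "graph_dist (cartesian_product G1 G2) (u, v) (u', v') =
    graph_dist G1 u u' + graph_dist G2 v v'"
proof (rule antisym)
  obtain p0 q0 where p0: "G1.awalk u p0 u'" and q0: "G2.awalk v q0 v'"
    using assms unfolding G1.connected_iff_awalk G2.connected_iff_awalk by blast
  obtain p where p: "G1.awalk u p u'" "graph_dist G1 u u' = real (length p)"
    using G1.graph_dist_attained[OF p0] by blast
  obtain q where q: "G2.awalk v q v'" "graph_dist G2 v v' = real (length q)"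
    using G2.graph_dist_attained[OF q0] by blast
  obtain r where r: "P.awalk (u, v) r (u', v')" "length r = length p + length q"
    using awalk_product_combine[OF p(1) q(1)] .
  show "graph_dist (cartesian_product G1 G2) (u, v) (u', v') \<le>
      graph_dist G1 u u' + graph_dist G2 v v'"
    using P.graph_dist_le_length[OF r(1)] p q r by simp
  obtain s where s: "P.awalk (u, v) s (u', v')"
    "graph_dist (cartesian_product G1 G2) (u, v) (u', v') = real (length s)"
    using P.graph_dist_attained[OF r(1)] by blast
  obtain p' q' where p': "G1.awalk u p' u'" and q': "G2.awalk v q' v'"
    and len: "length s = length p' + length q'"
    using awalk_product_project[OF s(1)] .
  show "graph_dist G1 u u' + graph_dist G2 v v' \<le>
      graph_dist (cartesian_product G1 G2) (u, v) (u', v')"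
    using G1.graph_dist_le_length[OF p'] G2.graph_dist_le_length[OF q'] s(2) len by simp
qed

end

section \<open>Euclidean embeddings\<close>

text \<open>
  Pythagoras for orthogonal summands: the first \<open>n\<close> coordinates carry \<open>f\<close>, the remaining \<open>m\<close>
  carry \<open>g\<close>. This turns the sum of the two distances into one squared distance.
\<close>

lemma L2_set_append_coordinates:
  fixes f g :: "nat \<Rightarrow> real"
  shows "(L2_set (\<lambda>k. if k < n then f k else g (k - n)) {..<n + m})\<^sup>2 =
     (L2_set f {..<n})\<^sup>2 + (L2_set g {..<m})\<^sup>2"
proof -
  have "(\<Sum>k<n + m. (if k < n then f k else g (k - n))\<^sup>2) = (\<Sum>k<n. (f k)\<^sup>2) + (\<Sum>k<m. (g k)\<^sup>2)"
    by (induction m) auto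
  then show ?thesis
    by (simp add: L2_set_def sum_nonneg)
qed

theorem corollary3p5:
  fixes G\<^sub>1 :: "'a pair_pre_digraph" and G\<^sub>2 :: "'b pair_pre_digraph"
  assumes "pair_graph G\<^sub>1" and "Digraph_Component.connected (with_proj G\<^sub>1)"
    and "pair_graph G\<^sub>2" and "Digraph_Component.connected (with_proj G\<^sub>2)"
  shows "qe_class (cartesian_product G\<^sub>1 G\<^sub>2) \<longleftrightarrow> qe_class G\<^sub>1 \<and> qe_class G\<^sub>2"
proof -
  interpret two_graphs G\<^sub>1 G\<^sub>2
    using assms by (simp add: two_graphs_def)
  note dist = graph_dist_cartesian_product[OF assms(2,4)]
  obtain a b where a: "a \<in> pverts G\<^sub>1" and b: "b \<in> pverts G\<^sub>2"
    using assms(2,4) unfolding G1.connected_iff_awalk G2.connected_iff_awalk by blast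
  show ?thesis
  proof
    assume "qe_class (cartesian_product G\<^sub>1 G\<^sub>2)"
    then obtain n :: nat and \<psi> where \<psi>: "\<And>i j. i \<in> pverts G\<^sub>1 \<times> pverts G\<^sub>2 \<Longrightarrow>
        j \<in> pverts G\<^sub>1 \<times> pverts G\<^sub>2 \<Longrightarrow>
        graph_dist (cartesian_product G\<^sub>1 G\<^sub>2) i j = (L2_set (\<lambda>k. \<psi> i k - \<psi> j k) {..<n})\<^sup>2"
      unfolding qe_class_def pverts_product by blast
    have "graph_dist G\<^sub>1 i j = (L2_set (\<lambda>k. \<psi> (i, b) k - \<psi> (j, b) k) {..<n})\<^sup>2"
      if "i \<in> pverts G\<^sub>1" "j \<in> pverts G\<^sub>1" for i j
      using \<psi>[of "(i, b)" "(j, b)"] dist[OF that b b] G2.graph_dist_self[OF b] that b by simp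
    moreover have "graph_dist G\<^sub>2 i j = (L2_set (\<lambda>k. \<psi> (a, i) k - \<psi> (a, j) k) {..<n})\<^sup>2"
      if "i \<in> pverts G\<^sub>2" "j \<in> pverts G\<^sub>2" for i j
      using \<psi>[of "(a, i)" "(a, j)"] dist[OF a a that] G1.graph_dist_self[OF a] that a by simp
    ultimately show "qe_class G\<^sub>1 \<and> qe_class G\<^sub>2"
      unfolding qe_class_def using assms(2,4)
      by (intro conjI exI[of _ n] exI[of _ "\<lambda>i. \<psi> (i, b)"] exI[of _ "\<lambda>i. \<psi> (a, i)"]) auto
  next
    assume "qe_class G\<^sub>1 \<and> qe_class G\<^sub>2"
    then obtain n m :: nat and \<phi> \<chi> where
      \<phi>: "\<And>i j. i \<in> pverts G\<^sub>1 \<Longrightarrow> j \<in> pverts G\<^sub>1 \<Longrightarrow>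
        graph_dist G\<^sub>1 i j = (L2_set (\<lambda>k. \<phi> i k - \<phi> j k) {..<n})\<^sup>2" and
      \<chi>: "\<And>i j. i \<in> pverts G\<^sub>2 \<Longrightarrow> j \<in> pverts G\<^sub>2 \<Longrightarrow>
        graph_dist G\<^sub>2 i j = (L2_set (\<lambda>k. \<chi> i k - \<chi> j k) {..<m})\<^sup>2"
      unfolding qe_class_def by blast
    define \<psi> where "\<psi> = (\<lambda>(i, j) k. if k < n then \<phi> i k else \<chi> j (k - n))"
    have "graph_dist (cartesian_product G\<^sub>1 G\<^sub>2) (u, v) (u', v') =
        (L2_set (\<lambda>k. \<psi> (u, v) k - \<psi> (u', v') k) {..<n + m})\<^sup>2"
      if "u \<in> pverts G\<^sub>1" "u' \<in> pverts G\<^sub>1" "v \<in> pverts G\<^sub>2" "v' \<in> pverts G\<^sub>2" for u v u' v'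
    proof -
      have "(\<lambda>k. \<psi> (u, v) k - \<psi> (u', v') k) =
          (\<lambda>k. if k < n then \<phi> u k - \<phi> u' k else \<chi> v (k - n) - \<chi> v' (k - n))"
        by (auto simp: \<psi>_def)
      then show ?thesis
        using that
        by (simp add: dist \<phi> \<chi> L2_set_append_coordinates[where g = "\<lambda>k. \<chi> v k - \<chi> v' k"])
    qed
    then show "qe_class (cartesian_product G\<^sub>1 G\<^sub>2)"
      unfolding qe_class_def pverts_product using connected_product[OF assms(2,4)]
      by (intro conjI exI[of _ "n + m"] exI[of _ \<psi>]) auto
  qed
qed

end
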